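(* Let $G$ be a finitely generated virtually abelian group, let $S$ be any finite generating set of $G$, and let $N$ be a torsion-free abelian normal subgroup of finite index in $G$. Let $\varphi\in\operatorname{End}(G)$ with $\varphi(N)\subset N$ and let $[g_0]_\varphi$ be a fixed $\varphi$-twisted conjugacy class of $G$ (with $g_0\in G$). Then $$\beta_{[g_0]_\varphi\subset G}^S(r)=\Theta(r^k)\quad\text{as } r\to\infty,$$ where $$k=\max\{\operatorname{rank}(\operatorname{Id}_N-\tau_g\circ\varphi|_N) \;:\; gN\in G/N \text{ and } [g_0]_\varphi\cap p^{-1}(gN)\neq\emptyset\}$$ and $p:G\to G/N$ denotes the projection of $G$ onto $G/N$.
   Context: For a group $G$ with finite generating set $S$, the word length $|g|_S$ of $g\in G$ is the minimal $k\in\mathbb{N}=\{0,1,2,\dots\}$ such that $g=s_1\cdots s_k$ with $s_i\in S\cup S^{-1}$. For a subset $U\subset G$, the subset growth of $U$ in $G$ is $\beta_{U\subset G}^S(r)=\#\{u\in U : |u|_S\le r\}$ for $r\in\mathbb{R}_{\ge0}$. For $\varphi\in\operatorname{End}(G)$, elements $g,h\in G$ are $\varphi$-twisted conjugate if there is $z\in G$ with $g=zh\varphi(z)^{-1}$. This is an equivalence relation; the class of $g$ is denoted $[g]_\varphi$. For $g\in G$, $\tau_g:G\to G:h\mapsto ghg^{-1}$. Here $N\cong\mathbb{Z}^{\operatorname{rank}(N)}$ is written additively in $\operatorname{Id}_N-\tau_g\circ\varphi|_N\in\operatorname{End}(N)$, and the rank of an endomorphism of $N$ is the rank of its image. Since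 $N$ is abelian, $\operatorname{Id}_N-\tau_g\circ\varphi|_N$ depends only on the coset $gN$. For non-negative functions $f,g$, $f(r)=\Theta(g(r))$ as $r\to\infty$ means that there are $c_1,c_2>0$ and $n_0\in\mathbb{N}_{>0}$ such that $c_1g(r)\le f(r)\le c_2g(r)$ for all $r\ge n_0$. *)

theory Defs
  imports "HOL-Algebra.Algebra" "HOL-Library.Landau_Symbols"
begin

definition virtually_abelian :: "('a, 'b) monoid_scheme \<Rightarrow> bool" where
  "virtually_abelian G \<longleftrightarrow>
     (\<exists>H. subgroup H G \<and> comm_group (G\<lparr>carrier := H\<rparr>) \<and> finite (rcosets\<^bsub>G\<^esub> H))"

definition torsion_free :: "('a, 'b) monoid_scheme \<Rightarrow> bool" where
  "torsion_free G \<longleftrightarrow>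
     (\<forall>x\<in>carrier G. \<forall>n::nat. 0 < n \<longrightarrow> x [^]\<^bsub>G\<^esub> n = \<one>\<^bsub>G\<^esub> \<longrightarrow> x = \<one>\<^bsub>G\<^esub>)"

definition word_length :: "('a, 'b) monoid_scheme \<Rightarrow> 'a set \<Rightarrow> 'a \<Rightarrow> nat" where
  "word_length G S g =
     (LEAST k. \<exists>ws. length ws = k \<and> set ws \<subseteq> S \<union> m_inv G ` S \<and>
                    foldr (\<otimes>\<^bsub>G\<^esub>) ws \<one>\<^bsub>G\<^esub> = g)"

definition subset_growth ::
    "('a, 'b) monoid_scheme \<Rightarrow> 'a set \<Rightarrow> 'a set \<Rightarrow> real \<Rightarrow> nat" where
  "subset_growth G S U r = card {u \<in> U. real (word_length G S u) \<le> r}"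

definition twisted_conj_class ::
    "('a, 'b) monoid_scheme \<Rightarrow> ('a \<Rightarrow> 'a) \<Rightarrow> 'a \<Rightarrow> 'a set" where
  "twisted_conj_class G \<phi> g =
     {h \<in> carrier G. \<exists>z\<in>carrier G. g = z \<otimes>\<^bsub>G\<^esub> h \<otimes>\<^bsub>G\<^esub> inv\<^bsub>G\<^esub> (\<phi> z)}"

definition inner_aut :: "('a, 'b) monoid_scheme \<Rightarrow> 'a \<Rightarrow> 'a \<Rightarrow> 'a" where
  "inner_aut G g h = g \<otimes>\<^bsub>G\<^esub> h \<otimes>\<^bsub>G\<^esub> inv\<^bsub>G\<^esub> g"

(* The group is isomorphic to Z^n for n = free_rank; meaningful only for free abelian
   groups of finite rank, such as the subgroups of a finitely generated torsion-free
   abelian group. *)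
definition free_rank :: "('a, 'b) monoid_scheme \<Rightarrow> nat" where
  "free_rank A = (THE n. A \<cong> product_group {..<n} (\<lambda>_. integer_group))"

definition endo_rank :: "('a, 'b) monoid_scheme \<Rightarrow> 'a set \<Rightarrow> ('a \<Rightarrow> 'a) \<Rightarrow> nat" where
  "endo_rank G N f = free_rank (G\<lparr>carrier := f ` N\<rparr>)"

(* The endomorphism Id - tau_g o phi of the abelian subgroup N, in the multiplicative
   notation of G. *)
definition id_minus_twist ::
    "('a, 'b) monoid_scheme \<Rightarrow> ('a \<Rightarrow> 'a) \<Rightarrow> 'a \<Rightarrow> 'a \<Rightarrow> 'a" where
  "id_minus_twist G \<phi> g x = x \<otimes>\<^bsub>G\<^esub> inv\<^bsub>G\<^esub> (inner_aut G g (\<phi> x))"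

(* The projection G -> G/N; the library builds G Mod N from right cosets, which agree
   with the left cosets gN because N is normal. *)
definition quot_proj :: "('a, 'b) monoid_scheme \<Rightarrow> 'a set \<Rightarrow> 'a \<Rightarrow> 'a set" where
  "quot_proj G N g = N #>\<^bsub>G\<^esub> g"

end

theory Submission
  imports Defs
begin

text \<open>
  Let \<open>C\<close> be the class of \<open>g\<^sub>0\<close> and \<open>D\<^sub>h = Id - \<tau>\<^sub>h \<circ> \<phi>\<close> on \<open>N\<close>. An element of \<open>C\<close> has the form
  \<open>z g\<^sub>0 \<phi>(z)\<inverse>\<close>. Write \<open>z = n t\<close> with \<open>n\<close> in \<open>N\<close> and \<open>t\<close> in a finite transversal, and put
  \<open>h = t g\<^sub>0 \<phi>(t)\<inverse>\<close>; then the element equals \<open>D\<^sub>h(n) h\<close> (\<open>twisted_translate\<close>). So \<open>C\<close> is a finite union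
  of cosets \<open>D\<^sub>h(N) h\<close> of subgroups of \<open>N\<close>, one at least for each coset of \<open>N\<close> that \<open>C\<close> meets, and
  it remains to see that a subgroup \<open>A\<close> of \<open>N\<close> of rank \<open>m\<close> has growth of order \<open>r\<^sup>m\<close> with respect to
  the word length of \<open>G\<close> (\<open>growth_of_subgroup\<close>). Translating by \<open>h\<close> changes lengths by a bounded
  amount, and the largest exponent wins.
  
  For the growth of \<open>A\<close>, Schreier's rewriting process (\<open>schreier_rewriting\<close>) turns a word of length \<open>l\<close> in
  the generators of \<open>G\<close> whose value is in \<open>N\<close> into a word of length \<open>l\<close> in a finite subset of \<open>N\<close>. Hence \<open>N\<close>
  is finitely generated, and every homomorphism from \<open>N\<close> to the integers is Lipschitz. Being torsion-free, \<open>N\<close>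
  has finitely many such homomorphisms that separate its elements
  (\<open>jointly_injective_coordinates\<close>). Row reduction (\<open>echelon_basis\<close>) yields a basis of
  \<open>A\<close> together with equally many of these coordinates that already separate the elements of \<open>A\<close>. The
  coordinates bound the number of elements of \<open>A\<close> in a ball from above, and the products of powers of basis
  elements bound it from below.
\<close>

section \<open>Ranks of free abelian groups\<close>

lemma product_integer_group_iso_free_Abelian_group:
  assumes "finite I"
  shows "product_group I (\<lambda>_. integer_group) \<cong> free_Abelian_group I"
proof -
  have "carrier (sum_group I (\<lambda>_. integer_group)) = carrier (product_group I (\<lambda>_. integer_group))"
    using assms by (simp add: carrier_sum_group)
  then have "sum_group I (\<lambda>_. integer_group) = product_group I (\<lambda>_. integer_group)"
    by (intro monoid.equality) simp_all
  then show ?thesis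
    using isomorphic_sum_integer_group by metis
qed

lemma product_integer_groups_iso_iff:
  assumes "finite I" "finite J"
  shows "product_group I (\<lambda>_. integer_group) \<cong> product_group J (\<lambda>_. integer_group) \<longleftrightarrow> card I = card J"
    (is "?PI \<cong> ?PJ \<longleftrightarrow> _")
proof -
  note I = product_integer_group_iso_free_Abelian_group[OF assms(1)]
  note J = product_integer_group_iso_free_Abelian_group[OF assms(2)]
  have I': "free_Abelian_group I \<cong> ?PI" by (rule group.iso_sym[OF _ I]) simp
  have J': "free_Abelian_group J \<cong> ?PJ" by (rule group.iso_sym[OF _ J]) simp
  have "?PI \<cong> ?PJ \<longleftrightarrow> free_Abelian_group I \<cong> free_Abelian_group J"
    using iso_trans[OF iso_trans[OF I' _] J] iso_trans[OF iso_trans[OF I _] J'] by blast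
  then show ?thesis
    using eqpoll_iff_card[OF assms] by (simp only: isomorphic_free_Abelian_groups)
qed

text \<open>
  The rank is a definite description, so it can be evaluated only because \<open>\<int>\<^sup>n\<close> determines \<open>n\<close>.
  An arbitrary finite index set is allowed because the bases constructed below are indexed by a set of
  pivots and not by an initial segment.
\<close>

lemma free_rank_eqI:
  assumes "finite J" "product_group J (\<lambda>_. integer_group) \<cong> A"
  shows "free_rank A = card J"
  unfolding free_rank_def
proof (rule the_equality)
  have A: "A \<cong> product_group J (\<lambda>_. integer_group)"
    by (rule group.iso_sym[OF _ assms(2)]) simp
  have "product_group J (\<lambda>_. integer_group) \<cong> product_group {..<card J} (\<lambda>_. integer_group)"
    using assms(1) by (simp only: product_integer_groups_iso_iff finite_lessThan card_lessThan)
  with A show "A \<cong> product_group {..<card J} (\<lambda>_. integer_group)" by (rule iso_trans)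
  fix n :: nat assume "A \<cong> product_group {..<n} (\<lambda>_. integer_group)"
  with assms(2) have "product_group J (\<lambda>_. integer_group) \<cong> product_group {..<n} (\<lambda>_. integer_group)"
    by (rule iso_trans)
  then show "n = card J"
    using assms(1) by (simp only: product_integer_groups_iso_iff finite_lessThan card_lessThan)
qed

section \<open>Integer coordinates and bases of torsion-free abelian groups\<close>

text \<open>
  Generators are adjoined one at a time. If \<open>x\<^sup>q\<close> lies in the old group \<open>M\<close> for some \<open>q > 0\<close>, then
  \<open>y \<mapsto> y\<^sup>q\<close> maps the new group \<open>M'\<close> into \<open>M\<close>, injectively since there is no torsion, and the old
  coordinates are composed with it. Otherwise \<open>M'\<close> is the direct product of \<open>M\<close> and the infinite cyclic
  group of \<open>x\<close>; the old coordinates are extended by the projection to \<open>M\<close>, and the exponent of \<open>x\<close> is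
  a new coordinate. In the first case a basis of \<open>M\<close> need not extend to one of \<open>M'\<close>, but joint injectivity
  persists, which is why coordinates are constructed first and bases afterwards.
\<close>

lemma (in comm_group) jointly_injective_coordinates:
  assumes "torsion_free G" "finite F" "F \<subseteq> carrier G"
  shows "\<exists>d (\<chi>::nat \<Rightarrow> 'a \<Rightarrow> int).
           (\<forall>i<d. \<chi> i \<in> hom (G\<lparr>carrier := generate G F\<rparr>) integer_group) \<and>
           (\<forall>x\<in>generate G F. (\<forall>i<d. \<chi> i x = 0) \<longrightarrow> x = \<one>)"
  using assms(2,3)
proof (induction F rule: finite_induct)
  case empty
  show ?case by (rule exI[of _ 0]) (simp add: generate_empty)
next
  case (insert x F)
  define M where "M = generate G F"
  define M' where "M' = generate G (insert x F)"
  have x: "x \<in> carrier G" and F: "F \<subseteq> carrier G" using insert.prems by auto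
  obtain d and \<chi> :: "nat \<Rightarrow> 'a \<Rightarrow> int"
    where hom: "\<And>i. i < d \<Longrightarrow> \<chi> i \<in> hom (G\<lparr>carrier := M\<rparr>) integer_group"
      and inj: "\<And>y. y \<in> M \<Longrightarrow> (\<And>i. i < d \<Longrightarrow> \<chi> i y = 0) \<Longrightarrow> y = \<one>"
    using insert.IH F unfolding M_def by blast
  have add: "\<chi> i (y \<otimes> z) = \<chi> i y + \<chi> i z" if "i < d" "y \<in> M" "z \<in> M" for i y z
    using hom[OF that(1)] that(2,3) by (auto simp: hom_def)
  have M: "subgroup M G" unfolding M_def by (rule generate_is_subgroup[OF F])
  interpret M: subgroup M G by (rule M)
  have M': "subgroup M' G" unfolding M'_def using x F by (intro generate_is_subgroup) auto
  have decomp: "\<exists>m\<in>M. \<exists>k::int. y = m \<otimes> x [^] k" if "y \<in> M'" for y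
    using that unfolding M'_def
  proof (induction rule: generate.induct)
    case one
    show ?case using M.one_closed by (intro bexI[of _ \<one>] exI[of _ 0]) auto
  next
    case (incl h)
    show ?case
    proof (cases "h = x")
      case True
      then show ?thesis using x M.one_closed by (intro bexI[of _ \<one>] exI[of _ 1]) auto
    next
      case False
      then have "h \<in> M" using incl by (auto simp: M_def intro: generate.incl)
      then show ?thesis using M.mem_carrier by (intro bexI[of _ h] exI[of _ 0]) auto
    qed
  next
    case (inv h)
    show ?case
    proof (cases "h = x")
      case True
      then show ?thesis using x M.one_closed
        by (intro bexI[of _ \<one>] exI[of _ "-1"]) (auto simp: int_pow_neg)
    next
      case False
      then have "inv h \<in> M" using inv by (auto simp: M_def intro: generate.inv)
      then show ?thesis using M.mem_carrier by (intro bexI[of _ "inv h"] exI[of _ 0]) auto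
    qed
  next
    case (eng h1 h2)
    then obtain m1 k1 m2 k2 where "m1 \<in> M" "h1 = m1 \<otimes> x [^] (k1::int)"
      "m2 \<in> M" "h2 = m2 \<otimes> x [^] (k2::int)" by blast
    moreover from this have "h1 \<otimes> h2 = (m1 \<otimes> m2) \<otimes> x [^] (k1 + k2)"
      using x M.mem_carrier by (simp add: int_pow_mult m_ac)
    ultimately show ?case by (meson M.m_closed)
  qed
  show ?case
  proof (cases "\<exists>q>0::nat. x [^] q \<in> M")
    case True
    then obtain q :: nat where q: "q > 0" "x [^] q \<in> M" by blast
    have pow: "y [^] q \<in> M" if y: "y \<in> M'" for y
    proof -
      obtain m k where mk: "m \<in> M" "y = m \<otimes> x [^] (k::int)" using decomp[OF y] by blast
      have "y [^] q = m [^] int q \<otimes> (x [^] int q) [^] k"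
        using mk x M.mem_carrier
        by (simp add: int_pow_int[symmetric] int_pow_distrib int_pow_pow mult.commute)
      also have "\<dots> \<in> M"
        using subgroup_int_pow_closed[OF M mk(1), of "int q"]
          subgroup_int_pow_closed[OF M, of "x [^] int q" k] q(2)
        by (simp add: int_pow_int)
      finally show ?thesis .
    qed
    define \<psi> where "\<psi> i y = \<chi> i (y [^] q)" for i y
    have "\<psi> i \<in> hom (G\<lparr>carrier := M'\<rparr>) integer_group" if "i < d" for i
      using pow add[OF that] subgroup.mem_carrier[OF M']
      by (auto simp: hom_def \<psi>_def nat_pow_distrib)
    moreover have "y = \<one>" if y: "y \<in> M'" "\<forall>i<d. \<psi> i y = 0" for y
    proof -
      have "y [^] q = \<one>" using y pow by (intro inj) (auto simp: \<psi>_def)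
      then show ?thesis
        using assms(1) q(1) subgroup.mem_carrier[OF M' y(1)] by (auto simp: torsion_free_def)
    qed
    ultimately show ?thesis unfolding M'_def by blast
  next
    case False
    have no_pow: "k = 0" if k: "x [^] (k::int) \<in> M" for k
    proof (rule ccontr)
      assume "k \<noteq> 0"
      have "x [^] (-k) \<in> M" using M.m_inv_closed[OF k] x by (simp add: int_pow_neg)
      with k have "x [^] \<bar>k\<bar> \<in> M" by (simp add: abs_if)
      moreover have "x [^] \<bar>k\<bar> = x [^] nat \<bar>k\<bar>" by (simp only: pow_nat abs_ge_zero)
      ultimately have "x [^] nat \<bar>k\<bar> \<in> M" by argo
      moreover have "0 < nat \<bar>k\<bar>" using \<open>k \<noteq> 0\<close> by simp
      ultimately have "\<exists>q>0::nat. x [^] q \<in> M" by (intro exI[of _ "nat \<bar>k\<bar>"] conjI)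
      with False show False by (rule notE)
    qed
    \<comment> \<open>The projections of the direct product: \<open>e\<close> to the exponent of \<open>x\<close>, \<open>p\<close> to \<open>M\<close>.\<close>
    define e where "e y = (THE k::int. y \<otimes> x [^] (-k) \<in> M)" for y
    have e: "e (m \<otimes> x [^] k) = k" if m: "m \<in> M" for m and k :: int
      unfolding e_def
    proof (rule the_equality)
      have canc: "m \<otimes> x [^] k \<otimes> x [^] (- k') = m \<otimes> x [^] (k - k')" for k' :: int
        using x M.mem_carrier[OF m] by (simp add: m_assoc int_pow_mult[symmetric])
      show "m \<otimes> x [^] k \<otimes> x [^] (- k) \<in> M" using canc[of k] m M.mem_carrier[OF m] by simp
      fix k' :: int assume "m \<otimes> x [^] k \<otimes> x [^] (- k') \<in> M"
      then have *: "m \<otimes> x [^] (k - k') \<in> M" by (simp add: canc)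
      have "x [^] (k - k') = inv m \<otimes> (m \<otimes> x [^] (k - k'))"
        using x M.mem_carrier[OF m] by (simp add: m_assoc[symmetric])
      also have "\<dots> \<in> M" using * m by blast
      finally show "k' = k" using no_pow by fastforce
    qed
    define p where "p y = y \<otimes> x [^] (- e y)" for y
    have p: "p (m \<otimes> x [^] k) = m" if m: "m \<in> M" for m and k :: int
      using x M.mem_carrier[OF m] e[OF m] by (simp add: p_def m_assoc int_pow_mult[symmetric])
    define \<psi> where "\<psi> i y = (if i < d then \<chi> i (p y) else e y)" for i y
    have "\<psi> i \<in> hom (G\<lparr>carrier := M'\<rparr>) integer_group" for i
    proof -
      have "\<psi> i (y \<otimes> z) = \<psi> i y + \<psi> i z" if "y \<in> M'" "z \<in> M'" for y z
      proof -
        obtain m k n l where y: "m \<in> M" "y = m \<otimes> x [^] (k::int)"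
          and z: "n \<in> M" "z = n \<otimes> x [^] (l::int)" using decomp \<open>y \<in> M'\<close> \<open>z \<in> M'\<close> by meson
        have "y \<otimes> z = (m \<otimes> n) \<otimes> x [^] (k + l)"
          using x y z M.mem_carrier by (simp add: int_pow_mult m_ac)
        then show ?thesis using y z e p add by (simp add: \<psi>_def)
      qed
      then show ?thesis by (auto simp: hom_def)
    qed
    moreover have "y = \<one>" if y: "y \<in> M'" "\<forall>i<Suc d. \<psi> i y = 0" for y
    proof -
      obtain m k where mk: "m \<in> M" "y = m \<otimes> x [^] (k::int)" using decomp[OF y(1)] by blast
      have "k = 0" using y(2) e mk by (auto simp: \<psi>_def)
      moreover have "m = \<one>"
        using mk y(2) p[OF mk(1)] by (intro inj) (auto simp: \<psi>_def less_Suc_eq)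
      ultimately show ?thesis using mk by simp
    qed
    ultimately show ?thesis unfolding M'_def by blast
  qed
qed

lemma (in comm_group) finprod_in_subgroup:
  assumes "subgroup A G" "f \<in> J \<rightarrow> A"
  shows "finprod G f J \<in> A"
proof -
  interpret A: subgroup A G by (rule assms(1))
  show ?thesis
    using assms(2)
  proof (induction J rule: infinite_finite_induct)
    case (insert j J)
    then have "f j \<in> A" "f \<in> J \<rightarrow> A" by auto
    then have "finprod G f (insert j J) = f j \<otimes> finprod G f J"
      using insert.hyps A.subset by (intro finprod_insert) (auto simp: Pi_iff)
    with insert \<open>f j \<in> A\<close> show ?case by auto
  qed auto
qed

text \<open>
  This is integral row reduction. Let \<open>A'\<close> be the part of \<open>A\<close> on which the last coordinate vanishes. If
  \<open>A' \<noteq> A\<close>, then an element \<open>a\<close> of \<open>A\<close> with the least positive last coordinate generates a complement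
  of \<open>A'\<close>, and that coordinate becomes a pivot. Since every basis element comes with its own pivot, the
  selected coordinates are as many as the rank of \<open>A\<close> and still tell its elements apart: this is what
  makes the upper and the lower bound for the growth of \<open>A\<close> have the same exponent.
\<close>

lemma (in comm_group) echelon_basis:
  fixes \<chi> :: "nat \<Rightarrow> 'a \<Rightarrow> int"
  assumes "subgroup A G"
    and "\<And>i. i < d \<Longrightarrow> \<chi> i \<in> hom G integer_group"
    and "\<And>x. x \<in> A \<Longrightarrow> (\<And>i. i < d \<Longrightarrow> \<chi> i x = 0) \<Longrightarrow> x = \<one>"
  shows "\<exists>J\<subseteq>{..<d}. \<exists>b\<in>J \<rightarrow> A.
           (\<forall>x\<in>A. (\<forall>j\<in>J. \<chi> j x = 0) \<longrightarrow> x = \<one>) \<and>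
           (\<forall>x\<in>A. \<exists>n::nat \<Rightarrow> int. x = (\<Otimes>j\<in>J. b j [^] n j)) \<and>
           (\<forall>n::nat \<Rightarrow> int. (\<Otimes>j\<in>J. b j [^] n j) = \<one> \<longrightarrow> (\<forall>j\<in>J. n j = 0))"
  using assms
proof (induction d arbitrary: A)
  case 0
  then have "A = {\<one>}" using subgroup.one_closed by fastforce
  then show ?case by auto
next
  case (Suc d)
  interpret A: subgroup A G by (rule Suc.prems(1))
  have homd: "\<chi> d \<in> hom G integer_group" using Suc.prems(2) by auto
  interpret \<chi>: group_hom G integer_group "\<chi> d"
    by unfold_locales (use homd group_integer_group in \<open>auto simp: group_def group_axioms_def\<close>)
  have add: "\<chi> d (x \<otimes> y) = \<chi> d x + \<chi> d y" if "x \<in> carrier G" "y \<in> carrier G" for x y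
    using \<chi>.hom_mult[OF that] by simp
  have zpow: "\<chi> d (x [^] k) = k * \<chi> d x" if "x \<in> carrier G" for x and k :: int
    using \<chi>.hom_int_pow[OF that] by simp
  define A' where "A' = {x\<in>A. \<chi> d x = 0}"
  have A': "subgroup A' G"
  proof (rule subgroupI)
    have "\<one> \<in> A'" using \<chi>.hom_one A.one_closed by (simp add: A'_def)
    then show "A' \<noteq> {}" by blast
  qed (use \<chi>.hom_inv in \<open>auto simp: A'_def add\<close>)
  have "\<exists>J\<subseteq>{..<d}. \<exists>b\<in>J \<rightarrow> A'.
          (\<forall>x\<in>A'. (\<forall>j\<in>J. \<chi> j x = 0) \<longrightarrow> x = \<one>) \<and>
          (\<forall>x\<in>A'. \<exists>n::nat \<Rightarrow> int. x = (\<Otimes>j\<in>J. b j [^] n j)) \<and>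
          (\<forall>n::nat \<Rightarrow> int. (\<Otimes>j\<in>J. b j [^] n j) = \<one> \<longrightarrow> (\<forall>j\<in>J. n j = 0))"
  proof (rule Suc.IH[OF A'])
    fix x assume "x \<in> A'" "\<And>i. i < d \<Longrightarrow> \<chi> i x = 0"
    then show "x = \<one>" by (intro Suc.prems(3)) (auto simp: A'_def less_Suc_eq)
  qed (use Suc.prems(2) in auto)
  then obtain J b where J: "J \<subseteq> {..<d}" and b: "b \<in> J \<rightarrow> A'"
    and inj: "\<forall>x\<in>A'. (\<forall>j\<in>J. \<chi> j x = 0) \<longrightarrow> x = \<one>"
    and span: "\<forall>x\<in>A'. \<exists>n::nat \<Rightarrow> int. x = (\<Otimes>j\<in>J. b j [^] n j)"
    and indep: "\<forall>n::nat \<Rightarrow> int. (\<Otimes>j\<in>J. b j [^] n j) = \<one> \<longrightarrow> (\<forall>j\<in>J. n j = 0)"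
    by (elim exE bexE conjE)
  have finJ: "finite J" and dJ: "d \<notin> J" using J finite_subset by auto
  show ?case
  proof (cases "\<forall>x\<in>A. \<chi> d x = 0")
    case True
    then have "A' = A" by (auto simp: A'_def)
    with J b inj span indep show ?thesis by (intro exI[of _ J] conjI bexI[of _ b]) auto
  next
    case False
    then obtain a0 where "a0 \<in> A" "\<chi> d a0 \<noteq> 0" by blast
    then have "\<chi> d a0 > 0 \<or> \<chi> d (inv a0) > 0"
      using \<chi>.hom_inv[of a0] A.mem_carrier by auto
    then have "\<exists>a\<in>A. \<chi> d a > 0"
      using \<open>a0 \<in> A\<close> A.m_inv_closed by blast
    then obtain a where a: "a \<in> A" "\<chi> d a > 0"
      and least: "\<And>y. y \<in> A \<Longrightarrow> \<chi> d y > 0 \<Longrightarrow> \<chi> d a \<le> \<chi> d y"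
      using ex_has_least_nat[of "\<lambda>a. a \<in> A \<and> \<chi> d a > 0" _ "\<lambda>a. nat (\<chi> d a)"]
      by (metis nat_le_eq_zle)
    note aG = A.mem_carrier[OF a(1)]
    \<comment> \<open>Division with remainder: the remainder would be a smaller positive value of the coordinate.\<close>
    have quot: "\<exists>t::int. y \<otimes> a [^] (- t) \<in> A'" if y: "y \<in> A" for y
    proof
      let ?t = "\<chi> d y div \<chi> d a"
      have mem: "y \<otimes> a [^] (- ?t) \<in> A"
        by (intro A.m_closed y subgroup_int_pow_closed[OF Suc.prems(1)] a)
      have "\<chi> d (y \<otimes> a [^] (- ?t)) = \<chi> d y mod \<chi> d a"
        using y aG A.mem_carrier by (simp add: add zpow minus_div_mult_eq_mod)
      then have "\<chi> d (y \<otimes> a [^] (- ?t)) = 0"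
        using least[OF mem] a(2) pos_mod_bound[of "\<chi> d a" "\<chi> d y"] pos_mod_sign[of "\<chi> d a" "\<chi> d y"]
        by linarith
      with mem show "y \<otimes> a [^] (- ?t) \<in> A'" by (simp add: A'_def)
    qed
    define J' where "J' = insert d J"
    define b' where "b' = b(d := a)"
    have bG: "b j \<in> carrier G" "b j \<in> A'" if "j \<in> J" for j
      using b that subgroup.mem_carrier[OF A'] by (auto simp only: Pi_iff)
    have prod_A': "(\<Otimes>j\<in>J. b j [^] n j) \<in> A'" for n :: "nat \<Rightarrow> int"
      using bG by (intro finprod_in_subgroup A') (auto intro!: subgroup_int_pow_closed[OF A'])
    have prod': "(\<Otimes>j\<in>J'. b' j [^] n j) = a [^] n d \<otimes> (\<Otimes>j\<in>J. b j [^] n j)" for n :: "nat \<Rightarrow> int"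
    proof -
      have "(\<Otimes>j\<in>J'. b' j [^] n j) = b' d [^] n d \<otimes> (\<Otimes>j\<in>J. b' j [^] n j)"
        unfolding J'_def using finJ dJ bG aG by (intro finprod_insert) (auto simp: b'_def)
      also have "(\<Otimes>j\<in>J. b' j [^] n j) = (\<Otimes>j\<in>J. b j [^] n j)"
        using dJ bG by (intro finprod_cong') (auto simp: b'_def)
      finally show ?thesis by (simp add: b'_def)
    qed
    show ?thesis
    proof (intro exI[of _ J'] conjI bexI[of _ b'])
      show "J' \<subseteq> {..<Suc d}" using J by (auto simp: J'_def)
      show "b' \<in> J' \<rightarrow> A" using bG a by (auto simp: J'_def b'_def A'_def)
      show "\<forall>x\<in>A. (\<forall>j\<in>J'. \<chi> j x = 0) \<longrightarrow> x = \<one>" using inj by (auto simp: J'_def A'_def)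
      show "\<forall>x\<in>A. \<exists>n::nat \<Rightarrow> int. x = (\<Otimes>j\<in>J'. b' j [^] n j)"
      proof
        fix x assume x: "x \<in> A"
        obtain t :: int where t: "x \<otimes> a [^] (- t) \<in> A'" using quot[OF x] by blast
        then obtain n :: "nat \<Rightarrow> int" where n: "x \<otimes> a [^] (- t) = (\<Otimes>j\<in>J. b j [^] n j)"
          using span by blast
        have "(\<Otimes>j\<in>J'. b' j [^] (n(d := t)) j) = a [^] t \<otimes> (\<Otimes>j\<in>J. b j [^] (n(d := t)) j)"
          using prod'[of "n(d := t)"] by simp
        also have "(\<Otimes>j\<in>J. b j [^] (n(d := t)) j) = (\<Otimes>j\<in>J. b j [^] n j)"
          using dJ bG by (intro finprod_cong') auto
        also have "a [^] t \<otimes> \<dots> = x"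
          unfolding n[symmetric] using A.mem_carrier[OF x] aG
          by (simp add: m_lcomm int_pow_mult[symmetric])
        finally show "\<exists>n::nat \<Rightarrow> int. x = (\<Otimes>j\<in>J'. b' j [^] n j)" by metis
      qed
      show "\<forall>n::nat \<Rightarrow> int. (\<Otimes>j\<in>J'. b' j [^] n j) = \<one> \<longrightarrow> (\<forall>j\<in>J'. n j = 0)"
      proof (intro allI impI)
        fix n :: "nat \<Rightarrow> int" assume n: "(\<Otimes>j\<in>J'. b' j [^] n j) = \<one>"
        have "\<chi> d (a [^] n d \<otimes> (\<Otimes>j\<in>J. b j [^] n j)) = n d * \<chi> d a"
          using prod_A'[of n] aG A.mem_carrier by (simp add: add zpow A'_def)
        then have "n d = 0" using n prod' a(2) \<chi>.hom_one by simp
        moreover have "(\<Otimes>j\<in>J. b j [^] n j) \<in> carrier G"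
          using prod_A'[of n] A.mem_carrier by (auto simp: A'_def)
        ultimately show "\<forall>j\<in>J'. n j = 0" using n prod'[of n] indep by (auto simp: J'_def)
      qed
    qed
  qed
qed

text \<open>
  Turns spanning and independence into an isomorphism, so that \<open>free_rank\<close> can be read off and
  exponent vectors can be counted.
\<close>

lemma (in comm_group) basis_iso:
  assumes A: "subgroup A G" and b: "b \<in> J \<rightarrow> A"
    and span: "\<And>x. x \<in> A \<Longrightarrow> \<exists>n::'j \<Rightarrow> int. x = (\<Otimes>j\<in>J. b j [^] n j)"
    and indep: "\<And>n::'j \<Rightarrow> int. (\<Otimes>j\<in>J. b j [^] n j) = \<one> \<Longrightarrow> \<forall>j\<in>J. n j = 0"
  shows "(\<lambda>n. \<Otimes>j\<in>J. b j [^] (n j :: int)) \<in>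
           iso (product_group J (\<lambda>_. integer_group)) (G\<lparr>carrier := A\<rparr>)"
proof -
  define \<Phi> where "\<Phi> n = (\<Otimes>j\<in>J. b j [^] (n j :: int))" for n
  have bG: "b j \<in> carrier G" if "j \<in> J" for j
    using b subgroup.mem_carrier[OF A] that by auto
  have closed: "\<Phi> n \<in> A" for n
    unfolding \<Phi>_def using b by (intro finprod_in_subgroup A) (auto intro!: subgroup_int_pow_closed[OF A])
  have closedG: "\<Phi> n \<in> carrier G" for n using closed subgroup.mem_carrier[OF A] by auto
  have add: "\<Phi> (\<lambda>j. n j + m j) = \<Phi> n \<otimes> \<Phi> m" for n m
  proof -
    have "\<Phi> (\<lambda>j. n j + m j) = (\<Otimes>j\<in>J. b j [^] n j \<otimes> b j [^] m j)"
      unfolding \<Phi>_def using bG by (intro finprod_cong') (auto simp: int_pow_mult)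
    also have "\<dots> = \<Phi> n \<otimes> \<Phi> m"
      unfolding \<Phi>_def using bG by (intro finprod_multf) auto
    finally show ?thesis .
  qed
  have restrict: "\<Phi> (restrict n J) = \<Phi> n" for n
    unfolding \<Phi>_def using bG by (intro finprod_cong') auto
  have "\<Phi> \<in> iso (product_group J (\<lambda>_. integer_group)) (G\<lparr>carrier := A\<rparr>)"
  proof (rule isoI)
    show "\<Phi> \<in> hom (product_group J (\<lambda>_. integer_group)) (G\<lparr>carrier := A\<rparr>)"
      using closed add by (auto simp: hom_def restrict)
    have "inj_on \<Phi> (J \<rightarrow>\<^sub>E UNIV)"
    proof (rule inj_onI)
      fix n m assume nm: "n \<in> J \<rightarrow>\<^sub>E UNIV" "m \<in> J \<rightarrow>\<^sub>E UNIV" "\<Phi> n = \<Phi> m"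
      have "\<Phi> (\<lambda>j. n j - m j) \<otimes> \<Phi> m = \<Phi> m" using add[of "\<lambda>j. n j - m j" m] nm(3) by simp
      then have "\<Phi> (\<lambda>j. n j - m j) = \<one>" using closedG by simp
      then have "\<forall>j\<in>J. n j = m j" using indep[of "\<lambda>j. n j - m j"] by (simp add: \<Phi>_def)
      with nm show "n = m" by (intro PiE_ext[of n J "\<lambda>_. UNIV" m]) auto
    qed
    moreover have "\<Phi> ` (J \<rightarrow>\<^sub>E UNIV) = A"
    proof (intro equalityI subsetI)
      fix x assume "x \<in> A"
      then obtain n where "x = \<Phi> n" using span unfolding \<Phi>_def by blast
      then have "x = \<Phi> (restrict n J)" by (simp add: restrict)
      then show "x \<in> \<Phi> ` (J \<rightarrow>\<^sub>E UNIV)"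
        by (intro image_eqI[of x \<Phi> "restrict n J"]) auto
    qed (use closed in auto)
    ultimately show "bij_betw \<Phi> (carrier (product_group J (\<lambda>_. integer_group))) (carrier (G\<lparr>carrier := A\<rparr>))"
      by (simp add: bij_betw_def)
  qed
  then show ?thesis unfolding \<Phi>_def by simp
qed

section \<open>Word length and Schreier rewriting\<close>

locale finitely_generated_group = group G for G (structure) +
  fixes S
  assumes finite_generators: "finite S"
    and generators_closed: "S \<subseteq> carrier G"
    and generators_generate: "generate G S = carrier G"
begin

abbreviation letters where "letters \<equiv> S \<union> m_inv G ` S"

abbreviation word_val where "word_val ws \<equiv> foldr (\<otimes>) ws \<one>"

lemma letters_closed: "letters \<subseteq> carrier G"
  using generators_closed by auto

lemma word_val_closed: "set ws \<subseteq> carrier G \<Longrightarrow> word_val ws \<in> carrier G"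
  by (induction ws) auto

lemma word_val_append:
  "set vs \<subseteq> carrier G \<Longrightarrow> set ws \<subseteq> carrier G \<Longrightarrow> word_val (vs @ ws) = word_val vs \<otimes> word_val ws"
  by (induction vs) (auto simp: m_assoc word_val_closed)

lemma ex_word:
  assumes "g \<in> carrier G"
  shows "\<exists>ws. set ws \<subseteq> letters \<and> word_val ws = g"
proof -
  have "g \<in> generate G S" using assms generators_generate by simp
  then show ?thesis
  proof (induction rule: generate.induct)
    case one
    show ?case by (rule exI[of _ "[]"]) simp
  next
    case (incl h)
    then show ?case using generators_closed by (intro exI[of _ "[h]"]) auto
  next
    case (inv h)
    then show ?case using generators_closed by (intro exI[of _ "[inv h]"]) auto
  next
    case (eng h1 h2)
    then obtain vs ws where "set vs \<subseteq> letters" "word_val vs = h1" "set ws \<subseteq> letters" "word_val ws = h2"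
      by blast
    then show ?case using letters_closed by (intro exI[of _ "vs @ ws"]) (subst word_val_append; auto)
  qed
qed

lemma geodesic_word:
  assumes "g \<in> carrier G"
  obtains ws where "length ws = word_length G S g" "set ws \<subseteq> letters" "word_val ws = g"
proof -
  have "\<exists>k ws. length ws = k \<and> set ws \<subseteq> letters \<and> word_val ws = g"
    using ex_word[OF assms] by blast
  from LeastI_ex[OF this] show ?thesis
    using that unfolding word_length_def by blast
qed

lemma word_length_le: "set ws \<subseteq> letters \<Longrightarrow> word_length G S (word_val ws) \<le> length ws"
  unfolding word_length_def by (intro Least_le) auto

lemma word_length_one [simp]: "word_length G S \<one> = 0"
  using word_length_le[of "[]"] by simp

lemma word_length_mult:
  assumes "g \<in> carrier G" "h \<in> carrier G"
  shows "word_length G S (g \<otimes> h) \<le> word_length G S g + word_length G S h"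
proof -
  obtain vs where vs: "length vs = word_length G S g" "set vs \<subseteq> letters" "word_val vs = g"
    using geodesic_word[OF assms(1)] .
  obtain ws where ws: "length ws = word_length G S h" "set ws \<subseteq> letters" "word_val ws = h"
    using geodesic_word[OF assms(2)] .
  have "word_val (vs @ ws) = g \<otimes> h"
    using vs ws letters_closed by (subst word_val_append) auto
  then show ?thesis using word_length_le[of "vs @ ws"] vs ws by auto
qed

lemma word_length_nat_pow:
  assumes "g \<in> carrier G"
  shows "word_length G S (g [^] (n::nat)) \<le> n * word_length G S g"
proof (induction n)
  case (Suc n)
  then show ?case using word_length_mult[of "g [^] n" g] assms by auto
qed simp

text \<open>
  The growth function is a cardinality, which would be \<open>0\<close> on an infinite set; finiteness
  of balls has to be known before any comparison of growth functions.
\<close>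

lemma finite_ball:
  assumes "U \<subseteq> carrier G"
  shows "finite {u \<in> U. real (word_length G S u) \<le> r}"
proof (rule finite_subset)
  show "{u \<in> U. real (word_length G S u) \<le> r}
          \<subseteq> word_val ` {ws. set ws \<subseteq> letters \<and> length ws \<le> nat \<lfloor>r\<rfloor>}"
  proof
    fix u assume u: "u \<in> {u \<in> U. real (word_length G S u) \<le> r}"
    then have "u \<in> carrier G" using assms by auto
    then obtain ws where "length ws = word_length G S u" "set ws \<subseteq> letters" "word_val ws = u"
      by (rule geodesic_word)
    moreover have "word_length G S u \<le> nat \<lfloor>r\<rfloor>" using u by (auto intro: le_nat_floor)
    ultimately show "u \<in> word_val ` {ws. set ws \<subseteq> letters \<and> length ws \<le> nat \<lfloor>r\<rfloor>}" by auto
  qed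
  show "finite (word_val ` {ws. set ws \<subseteq> letters \<and> length ws \<le> nat \<lfloor>r\<rfloor>})"
    using finite_generators by (intro finite_imageI finite_lists_length_le) auto
qed

lemma subset_growth_mono:
  assumes "V \<subseteq> carrier G" "U \<subseteq> V"
  shows "subset_growth G S U r \<le> subset_growth G S V r"
  unfolding subset_growth_def using assms by (intro card_mono finite_ball) auto

lemma subset_growth_UN_le:
  assumes "finite I"
  shows "subset_growth G S (\<Union>i\<in>I. U i) r \<le> (\<Sum>i\<in>I. subset_growth G S (U i) r)"
proof -
  have "{u \<in> (\<Union>i\<in>I. U i). real (word_length G S u) \<le> r} =
        (\<Union>i\<in>I. {u \<in> U i. real (word_length G S u) \<le> r})" by auto
  then show ?thesis unfolding subset_growth_def by (simp only: card_UN_le[OF assms])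
qed

lemma subset_growth_translate:
  assumes "U \<subseteq> carrier G" "h \<in> carrier G"
  shows "subset_growth G S U r \<le> subset_growth G S (U #> h) (r + real (word_length G S h))"
  unfolding subset_growth_def
proof (rule card_inj_on_le)
  show "inj_on (\<lambda>u. u \<otimes> h) {u \<in> U. real (word_length G S u) \<le> r}"
    by (rule inj_on_subset[OF inj_on_multc[OF assms(2)]]) (use assms in auto)
  show "(\<lambda>u. u \<otimes> h) ` {u \<in> U. real (word_length G S u) \<le> r}
     \<subseteq> {u \<in> U #> h. real (word_length G S u) \<le> r + real (word_length G S h)}"
  proof clarify
    fix u assume u: "u \<in> U" "real (word_length G S u) \<le> r"
    then have "word_length G S (u \<otimes> h) \<le> word_length G S u + word_length G S h"
      using assms by (intro word_length_mult) auto
    then show "u \<otimes> h \<in> U #> h \<and> real (word_length G S (u \<otimes> h)) \<le> r + real (word_length G S h)"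
      using u by (auto simp: r_coset_def)
  qed
  show "finite {u \<in> U #> h. real (word_length G S u) \<le> r + real (word_length G S h)}"
    using assms by (intro finite_ball r_coset_subset_G)
qed

text \<open>
  Schreier's rewriting process. With \<open>rep g\<close> the representative of the coset of \<open>g\<close>, the element
  \<open>\<nu> g = (rep g)\<inverse> g\<close> of \<open>N\<close> satisfies \<open>\<nu> (s g) = \<nu> (s (rep g)) \<nu> g\<close>. So each letter of a word
  contributes one factor from the finite set \<open>F\<close> of all \<open>\<nu> (s t)\<close>, with \<open>s\<close> a letter and \<open>t\<close> a
  representative. The length is preserved, hence \<open>F\<close> generates \<open>N\<close> and the inclusion of \<open>N\<close> into \<open>G\<close>
  does not distort lengths.
\<close>

lemma schreier_rewriting:
  assumes N: "N \<lhd> G" and index: "finite (rcosets N)"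
  shows "\<exists>F\<subseteq>N. finite F \<and>
           (\<forall>n\<in>N. \<exists>vs. length vs = word_length G S n \<and> set vs \<subseteq> F \<and> word_val vs = n)"
proof -
  interpret N: normal N G by (rule N)
  have subN: "subgroup N G" by (rule N.subgroup_axioms)
  \<comment> \<open>The trivial coset is represented by \<open>\<one>\<close>, so that \<open>\<nu>\<close> is the identity on \<open>N\<close>.\<close>
  define \<rho> where "\<rho> C = (if C = N then \<one> else SOME x. x \<in> C)" for C
  define rep where "rep g = \<rho> (N #> g)" for g
  define \<nu> where "\<nu> g = inv (rep g) \<otimes> g" for g
  have rep_coset: "rep g \<in> N #> g" if "g \<in> carrier G" for g
    using rcos_self[OF that subN] N.one_closed
    by (auto simp: rep_def \<rho>_def intro: someI[of "\<lambda>x. x \<in> N #> g"])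
  then have rep_closed: "rep g \<in> carrier G" if "g \<in> carrier G" for g
    using that N.elemrcos_carrier is_group by blast
  have rep_N: "rep n = \<one>" if "n \<in> N" for n
    using that N.rcos_const is_group by (simp add: rep_def \<rho>_def)
  have \<nu>_closed: "\<nu> g \<in> N" if g: "g \<in> carrier G" for g
  proof -
    obtain n where n: "n \<in> N" "rep g = n \<otimes> g" using rep_coset[OF g] by (auto simp: r_coset_def)
    have "\<nu> g = inv g \<otimes> inv n \<otimes> g"
      using n g N.mem_carrier by (simp add: \<nu>_def inv_mult_group m_assoc)
    also have "\<dots> \<in> N" using n g by (intro N.inv_op_closed1) auto
    finally show ?thesis .
  qed
  have rep_mult: "rep (s \<otimes> rep g) = rep (s \<otimes> g)" if "s \<in> carrier G" "g \<in> carrier G" for s g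
  proof -
    have "N #> rep g = N #> g" using rep_coset that repr_independence subN by metis
    then have "N #> (s \<otimes> rep g) = N #> (s \<otimes> g)"
      using that rep_closed by (metis N.rcos_sum)
    then show ?thesis by (simp add: rep_def)
  qed
  define F where "F = (\<lambda>(s, t). \<nu> (s \<otimes> t)) ` (letters \<times> rep ` carrier G)"
  have rep_finite: "finite (rep ` carrier G)"
  proof (rule finite_subset)
    show "rep ` carrier G \<subseteq> \<rho> ` (rcosets N)" by (auto simp: rep_def RCOSETS_def)
  qed (use index in simp)
  have "F \<subseteq> N"
    using letters_closed rep_closed by (auto simp: F_def intro!: \<nu>_closed)
  moreover have "finite F"
    unfolding F_def using rep_finite finite_generators by auto
  moreover have "\<exists>vs. length vs = length ws \<and> set vs \<subseteq> F \<and> word_val vs = \<nu> (word_val ws)"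
    if "set ws \<subseteq> letters" for ws
    using that
  proof (induction ws)
    case Nil
    then show ?case using rep_N[OF N.one_closed] by (simp add: \<nu>_def)
  next
    case (Cons s ws)
    then obtain vs where vs: "length vs = length ws" "set vs \<subseteq> F" "word_val vs = \<nu> (word_val ws)"
      by auto
    define g where "g = word_val ws"
    have g: "g \<in> carrier G" and s: "s \<in> carrier G" "s \<in> letters"
      using Cons.prems letters_closed unfolding g_def by (auto intro!: word_val_closed)
    note c = g s rep_closed[OF g] rep_closed[of "s \<otimes> g"]
    have "\<nu> (s \<otimes> rep g) \<otimes> \<nu> g = inv (rep (s \<otimes> g)) \<otimes> (s \<otimes> (rep g \<otimes> (inv (rep g) \<otimes> g)))"
      using c rep_mult[OF s(1) g] by (simp add: \<nu>_def m_assoc)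
    also have "rep g \<otimes> (inv (rep g) \<otimes> g) = g"
      using c by (simp add: m_assoc[symmetric])
    finally have "word_val (\<nu> (s \<otimes> rep g) # vs) = \<nu> (word_val (s # ws))"
      using vs by (simp add: g_def \<nu>_def)
    moreover have "\<nu> (s \<otimes> rep g) \<in> F" using s g unfolding F_def by auto
    ultimately show ?case using vs by (intro exI[of _ "\<nu> (s \<otimes> rep g) # vs"]) auto
  qed
  moreover have "\<nu> n = n" if "n \<in> N" for n
    using rep_N[OF that] that N.mem_carrier by (simp add: \<nu>_def)
  ultimately have "\<exists>vs. length vs = word_length G S n \<and> set vs \<subseteq> F \<and> word_val vs = n" if "n \<in> N" for n
    using geodesic_word[OF N.mem_carrier[OF that]] that by metis
  with \<open>F \<subseteq> N\<close> \<open>finite F\<close> show ?thesis by blast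
qed

end

section \<open>Growth of subgroups of an abelian normal subgroup of finite index\<close>

locale virtually_abelian_pair = finitely_generated_group + normal N G for N +
  assumes comm_N: "comm_group (G\<lparr>carrier := N\<rparr>)"
    and torsion_free_N: "torsion_free (G\<lparr>carrier := N\<rparr>)"
    and finite_index: "finite (rcosets N)"
begin

abbreviation NG where "NG \<equiv> G\<lparr>carrier := N\<rparr>"

lemma N_subgroup: "subgroup N G" by (rule subgroup_axioms)

text \<open>
  A homomorphism to the integers is bounded on the finitely many Schreier generators, and a word in
  them is no longer than the geodesic word in the generators of \<open>G\<close> that it rewrites.
\<close>

lemma hom_N_Lipschitz:
  assumes "\<chi> \<in> hom NG integer_group"
  shows "\<exists>K::nat. \<forall>n\<in>N. nat \<bar>\<chi> n\<bar> \<le> K * word_length G S n"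
proof -
  interpret NG: comm_group NG by (rule comm_N)
  have add: "\<chi> (x \<otimes> y) = \<chi> x + \<chi> y" if "x \<in> N" "y \<in> N" for x y
    using assms that by (auto simp: hom_def)
  have one: "\<chi> \<one> = 0" using add[of \<one> \<one>] one_closed by simp
  obtain F where F: "F \<subseteq> N" "finite F"
    and rewrite: "\<And>n. n \<in> N \<Longrightarrow> \<exists>vs. length vs = word_length G S n \<and> set vs \<subseteq> F \<and> word_val vs = n"
    using schreier_rewriting[OF normal_axioms finite_index] by blast
  define K where "K = (\<Sum>f\<in>F. nat \<bar>\<chi> f\<bar>)"
  have K: "nat \<bar>\<chi> f\<bar> \<le> K" if "f \<in> F" for f
    unfolding K_def using F that by (intro member_le_sum) auto
  have "word_val vs \<in> N \<and> nat \<bar>\<chi> (word_val vs)\<bar> \<le> K * length vs" if "set vs \<subseteq> F" for vs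
    using that
  proof (induction vs)
    case (Cons v vs)
    then have "v \<in> N" "word_val vs \<in> N" "nat \<bar>\<chi> (word_val vs)\<bar> \<le> K * length vs" "nat \<bar>\<chi> v\<bar> \<le> K"
      using F K by auto
    then show ?case by (simp add: add)
  qed (simp add: one)
  then show ?thesis using rewrite by metis
qed

lemma N_coordinates:
  "\<exists>d (\<chi>::nat \<Rightarrow> 'a \<Rightarrow> int). (\<forall>i<d. \<chi> i \<in> hom NG integer_group) \<and>
     (\<forall>x\<in>N. (\<forall>i<d. \<chi> i x = 0) \<longrightarrow> x = \<one>)"
proof -
  interpret NG: comm_group NG by (rule comm_N)
  obtain F where F: "F \<subseteq> N" "finite F"
    and rewrite: "\<And>n. n \<in> N \<Longrightarrow> \<exists>vs. length vs = word_length G S n \<and> set vs \<subseteq> F \<and> word_val vs = n"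
    using schreier_rewriting[OF normal_axioms finite_index] by blast
  have "word_val vs \<in> generate NG F" if "set vs \<subseteq> F" for vs
    using that
  proof (induction vs)
    case Nil
    then show ?case using generate.one[of NG F] by simp
  next
    case (Cons v vs)
    then show ?case using generate.eng[of v NG F "word_val vs"] by (auto intro: generate.incl)
  qed
  then have "N \<subseteq> generate NG F" using rewrite by (metis subsetI)
  then have gen: "generate NG F = N" using NG.generate_incl[of F] F by auto
  have "\<exists>d (\<chi>::nat \<Rightarrow> 'a \<Rightarrow> int).
           (\<forall>i<d. \<chi> i \<in> hom (NG\<lparr>carrier := generate NG F\<rparr>) integer_group) \<and>
           (\<forall>x\<in>generate NG F. (\<forall>i<d. \<chi> i x = 0) \<longrightarrow> x = \<one>\<^bsub>NG\<^esub>)"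
    using F by (intro NG.jointly_injective_coordinates torsion_free_N) auto
  then show ?thesis by (simp add: gen)
qed

text \<open>
  Let \<open>m\<close> be the rank of \<open>A\<close>. The \<open>m\<close> pivot coordinates are injective on \<open>A\<close> and of size \<open>O(R)\<close> on the ball of
  radius \<open>R\<close>, which leaves \<open>O(R\<^sup>m)\<close> possible values. Conversely, products of the \<open>m\<close> basis elements
  with exponents between \<open>0\<close> and a small multiple of \<open>R\<close> are pairwise different elements of the ball.
\<close>

lemma growth_of_subgroup:
  assumes A: "subgroup A G" "A \<subseteq> N"
  defines "m \<equiv> free_rank (G\<lparr>carrier := A\<rparr>)"
  shows "\<exists>c>0. \<exists>C>0. \<forall>R\<ge>1. c * R ^ m \<le> real (subset_growth G S A R) \<and>
           real (subset_growth G S A R) \<le> C * R ^ m"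
proof -
  interpret NG: comm_group NG by (rule comm_N)
  have A_NG: "subgroup A NG" by (rule subgroup_incl[OF A(1) N_subgroup A(2)])
  have AG: "A \<subseteq> carrier G" using A(1) by (rule subgroup.subset)
  obtain d and \<chi> :: "nat \<Rightarrow> 'a \<Rightarrow> int"
    where hom: "\<And>i. i < d \<Longrightarrow> \<chi> i \<in> hom NG integer_group"
      and inj_N: "\<forall>x\<in>N. (\<forall>i<d. \<chi> i x = 0) \<longrightarrow> x = \<one>"
    using N_coordinates by metis
  have "\<exists>J\<subseteq>{..<d}. \<exists>b\<in>J \<rightarrow> A.
           (\<forall>x\<in>A. (\<forall>j\<in>J. \<chi> j x = 0) \<longrightarrow> x = \<one>\<^bsub>NG\<^esub>) \<and>
           (\<forall>x\<in>A. \<exists>n::nat \<Rightarrow> int. x = (\<Otimes>\<^bsub>NG\<^esub>j\<in>J. b j [^]\<^bsub>NG\<^esub> n j)) \<and>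
           (\<forall>n::nat \<Rightarrow> int. (\<Otimes>\<^bsub>NG\<^esub>j\<in>J. b j [^]\<^bsub>NG\<^esub> n j) = \<one>\<^bsub>NG\<^esub> \<longrightarrow> (\<forall>j\<in>J. n j = 0))"
  proof (rule NG.echelon_basis[OF A_NG hom])
    show "x = \<one>\<^bsub>NG\<^esub>" if "x \<in> A" "\<And>i. i < d \<Longrightarrow> \<chi> i x = 0" for x
      using inj_N that A(2) by auto
  qed
  then obtain J b where J: "J \<subseteq> {..<d}" and b: "b \<in> J \<rightarrow> A"
    and inj: "\<forall>x\<in>A. (\<forall>j\<in>J. \<chi> j x = 0) \<longrightarrow> x = \<one>\<^bsub>NG\<^esub>"
    and span: "\<forall>x\<in>A. \<exists>n::nat \<Rightarrow> int. x = (\<Otimes>\<^bsub>NG\<^esub>j\<in>J. b j [^]\<^bsub>NG\<^esub> n j)"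
    and indep: "\<forall>n::nat \<Rightarrow> int. (\<Otimes>\<^bsub>NG\<^esub>j\<in>J. b j [^]\<^bsub>NG\<^esub> n j) = \<one>\<^bsub>NG\<^esub> \<longrightarrow> (\<forall>j\<in>J. n j = 0)"
    by (elim exE bexE conjE)
  have finJ: "finite J" using J finite_subset by auto
  define \<Phi> where "\<Phi> n = (\<Otimes>\<^bsub>NG\<^esub>j\<in>J. b j [^]\<^bsub>NG\<^esub> (n j :: int))" for n
  have iso: "\<Phi> \<in> iso (product_group J (\<lambda>_. integer_group)) (G\<lparr>carrier := A\<rparr>)"
    using NG.basis_iso[OF A_NG b] span indep unfolding \<Phi>_def by simp
  then have "free_rank (G\<lparr>carrier := A\<rparr>) = card J"
    by (intro free_rank_eqI[OF finJ]) (auto simp: is_iso_def)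
  then have m: "m = card J" by (simp add: m_def)
  have \<Phi>_inj: "inj_on \<Phi> (J \<rightarrow>\<^sub>E UNIV)" and \<Phi>_A: "\<Phi> ` (J \<rightarrow>\<^sub>E UNIV) = A"
    using iso by (simp_all add: iso_def bij_betw_def)

  have "\<exists>C>0. \<forall>R\<ge>1. real (subset_growth G S A R) \<le> C * R ^ m"
  proof -
    have "\<exists>K::nat. \<forall>n\<in>N. nat \<bar>\<chi> j n\<bar> \<le> K * word_length G S n" if "j \<in> J" for j
      using hom_N_Lipschitz[OF hom[of j]] J that by auto
    then obtain K where K: "\<And>j n. j \<in> J \<Longrightarrow> n \<in> N \<Longrightarrow> nat \<bar>\<chi> j n\<bar> \<le> K j * word_length G S n"
      by metis
    define L where "L = (\<Sum>j\<in>J. K j)"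
    have L: "nat \<bar>\<chi> j n\<bar> \<le> L * word_length G S n" if "j \<in> J" "n \<in> N" for j n
    proof -
      have "K j \<le> L" unfolding L_def using finJ that by (intro member_le_sum) auto
      then show ?thesis using K[OF that] by (meson le_trans mult_le_mono1)
    qed
    have "real (subset_growth G S A R) \<le> (2 * real L + 1) ^ m * R ^ m" if R: "R \<ge> 1" for R
    proof -
      define B where "B = int L * \<lfloor>R\<rfloor>"
      have B0: "B \<ge> 0" using R by (auto simp: B_def)
      let ?U = "{u \<in> A. real (word_length G S u) \<le> R}"
      let ?f = "\<lambda>u. \<lambda>j\<in>J. \<chi> j u"
      have "inj_on ?f ?U"
      proof (rule inj_onI)
        fix u v assume uv: "u \<in> ?U" "v \<in> ?U" "?f u = ?f v"
        have uvA: "u \<in> A" "v \<in> A" "u \<in> N" "v \<in> N" using uv A by auto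
        have "\<chi> j (u \<otimes> inv v) = 0" if "j \<in> J" for j
        proof -
          have j: "\<chi> j \<in> hom NG integer_group" using hom J that by auto
          then have add: "\<chi> j (x \<otimes> y) = \<chi> j x + \<chi> j y" if "x \<in> N" "y \<in> N" for x y
            using that by (auto simp: hom_def)
          have "\<chi> j (u \<otimes> inv v) + \<chi> j v = \<chi> j (u \<otimes> inv v \<otimes> v)"
            using uvA by (subst add) auto
          also have "u \<otimes> inv v \<otimes> v = u" using uvA mem_carrier by (simp add: m_assoc)
          finally show ?thesis using fun_cong[OF uv(3), of j] that by simp
        qed
        moreover have "u \<otimes> inv v \<in> A"
          using uvA A(1) by (simp add: subgroup.m_closed subgroup.m_inv_closed)
        ultimately have "u \<otimes> inv v = \<one>" using inj by auto
        then show "u = v" using uvA mem_carrier by (metis inv_equality inv_inv inv_closed)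
      qed
      moreover have "?f ` ?U \<subseteq> J \<rightarrow>\<^sub>E {-B..B}"
      proof -
        have "\<bar>\<chi> j u\<bar> \<le> B" if "u \<in> ?U" "j \<in> J" for u j
        proof -
          have "nat \<bar>\<chi> j u\<bar> \<le> L * word_length G S u" using L that A(2) by auto
          then have "\<bar>\<chi> j u\<bar> \<le> int L * int (word_length G S u)"
            by (metis of_nat_mult nat_le_iff)
          moreover have "int L * int (word_length G S u) \<le> B"
            unfolding B_def using that(1) by (intro mult_left_mono) (auto simp: le_floor_iff)
          ultimately show ?thesis by linarith
        qed
        then show ?thesis by (force simp: abs_le_iff)
      qed
      ultimately have "card ?U \<le> card (J \<rightarrow>\<^sub>E {-B..B})"
        using finJ by (intro card_inj_on_le[of ?f]) (auto intro: finite_PiE)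
      also have "\<dots> = nat (2 * B + 1) ^ m"
        using finJ B0 by (simp add: card_PiE m algebra_simps)
      finally have "real (card ?U) \<le> real (nat (2 * B + 1)) ^ m"
        by (metis of_nat_le_iff of_nat_power)
      also have "\<dots> \<le> ((2 * real L + 1) * R) ^ m"
      proof (intro power_mono)
        have "real (nat (2 * B + 1)) = 2 * (real L * of_int \<lfloor>R\<rfloor>) + 1"
          using B0 by (simp add: B_def)
        also have "\<dots> \<le> 2 * (real L * R) + R"
          using R by (intro add_mono mult_left_mono) auto
        finally show "real (nat (2 * B + 1)) \<le> (2 * real L + 1) * R" by (simp add: algebra_simps)
      qed simp
      finally show ?thesis by (simp add: subset_growth_def power_mult_distrib)
    qed
    then show ?thesis by (intro exI[of _ "(2 * real L + 1) ^ m"]) auto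
  qed

  moreover have "\<exists>c>0. \<forall>R\<ge>1. c * R ^ m \<le> real (subset_growth G S A R)"
  proof -
    \<comment> \<open>The successor keeps \<open>L\<close> positive when \<open>A\<close> is trivial.\<close>
    define L where "L = Suc (\<Sum>j\<in>J. word_length G S (b j))"
    have bN: "b j \<in> N" if "j \<in> J" for j using b A(2) that by auto
    have bound: "word_length G S (\<Phi> n) \<le> q * L" if n: "n \<in> J \<rightarrow> {0..int q}" for n q
    proof -
      have "word_length G S (\<Otimes>\<^bsub>NG\<^esub>j\<in>I. b j [^]\<^bsub>NG\<^esub> n j) \<le> q * (\<Sum>j\<in>I. word_length G S (b j))"
        if "finite I" "I \<subseteq> J" for I
        using that
      proof (induction I rule: finite_induct)
        case (insert i I)
        have IJ: "b j \<in> N" if "j \<in> insert i I" for j using bN insert.prems that by auto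
        then have pow: "b j [^]\<^bsub>NG\<^esub> n j \<in> N" if "j \<in> insert i I" for j
          using NG.int_pow_closed[of "b j" "n j"] that by simp
        then have prodN: "(\<Otimes>\<^bsub>NG\<^esub>j\<in>I. b j [^]\<^bsub>NG\<^esub> n j) \<in> N"
          using NG.finprod_closed[of "\<lambda>j. b j [^]\<^bsub>NG\<^esub> n j" I] by auto
        have eq: "(\<Otimes>\<^bsub>NG\<^esub>j\<in>insert i I. b j [^]\<^bsub>NG\<^esub> n j) =
              b i [^]\<^bsub>NG\<^esub> n i \<otimes> (\<Otimes>\<^bsub>NG\<^esub>j\<in>I. b j [^]\<^bsub>NG\<^esub> n j)"
          using NG.finprod_insert[of I i "\<lambda>j. b j [^]\<^bsub>NG\<^esub> n j"] insert.hyps pow by auto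
        obtain t where t: "n i = int t" "t \<le> q"
          using n insert.prems by (auto simp: Pi_iff) (metis nonneg_int_cases of_nat_le_iff)
        have "b i [^]\<^bsub>NG\<^esub> n i = b i [^] t"
          by (simp add: t int_pow_int nat_pow_def)
        then have "word_length G S (b i [^]\<^bsub>NG\<^esub> n i) \<le> t * word_length G S (b i)"
          using word_length_nat_pow IJ mem_carrier by simp
        also have "\<dots> \<le> q * word_length G S (b i)" using t by simp
        finally have "word_length G S (b i [^]\<^bsub>NG\<^esub> n i) \<le> q * word_length G S (b i)" .
        moreover have "word_length G S (\<Otimes>\<^bsub>NG\<^esub>j\<in>insert i I. b j [^]\<^bsub>NG\<^esub> n j)
             \<le> word_length G S (b i [^]\<^bsub>NG\<^esub> n i) + word_length G S (\<Otimes>\<^bsub>NG\<^esub>j\<in>I. b j [^]\<^bsub>NG\<^esub> n j)"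
          unfolding eq using pow prodN mem_carrier by (intro word_length_mult) auto
        ultimately show ?case using insert by (simp add: distrib_left)
      qed simp
      from this[OF finJ order_refl] show ?thesis
        unfolding \<Phi>_def L_def by (simp add: le_trans)
    qed
    have "(1 / real L) ^ m * R ^ m \<le> real (subset_growth G S A R)" if R: "R \<ge> 1" for R
    proof -
      define q where "q = nat \<lfloor>R / real L\<rfloor>"
      let ?U = "{u \<in> A. real (word_length G S u) \<le> R}"
      have L0: "real L > 0" by (simp only: of_nat_0_less_iff L_def zero_less_Suc)
      have q: "real q \<le> R / real L" "R / real L < real q + 1"
        using R L0 by (auto simp: q_def) 
      have "\<Phi> ` (J \<rightarrow>\<^sub>E {0..int q}) \<subseteq> ?U"
      proof (intro image_subsetI)
        fix n assume n: "n \<in> J \<rightarrow>\<^sub>E {0..int q}"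
        then have "real (word_length G S (\<Phi> n)) \<le> real q * real L"
          using bound[of n q] by (metis PiE_iff Pi_I of_nat_le_iff of_nat_mult)
        also have "\<dots> \<le> R" using q(1) L0 by (simp add: field_simps)
        moreover have "\<Phi> n \<in> A" using n \<Phi>_A by (auto simp: PiE_iff)
        ultimately show "\<Phi> n \<in> ?U" by auto
      qed
      moreover have "inj_on \<Phi> (J \<rightarrow>\<^sub>E {0..int q})"
        by (rule inj_on_subset[OF \<Phi>_inj]) auto
      ultimately have "card (J \<rightarrow>\<^sub>E {0..int q}) \<le> card ?U"
        using finite_ball[OF AG] by (intro card_inj_on_le) auto
      moreover have "nat (int q + 1) = q + 1" by simp
      ultimately have "(q + 1) ^ m \<le> card ?U"
        using finJ by (simp only: card_PiE m card_atLeastAtMost_int prod_constant diff_zero)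
      then have "(real q + 1) ^ m \<le> real (card ?U)"
        by (metis of_nat_1 of_nat_add of_nat_le_iff of_nat_power)
      moreover have "(R / real L) ^ m \<le> (real q + 1) ^ m"
        using q R L0 by (intro power_mono) auto
      ultimately show ?thesis by (simp add: subset_growth_def power_divide)
    qed
    moreover have "L > 0" unfolding L_def by (rule zero_less_Suc)
    then have "(1 / real L) ^ m > 0" by simp
    ultimately show ?thesis by blast
  qed
  ultimately show ?thesis by blast
qed

text \<open>
  Translation by \<open>h\<close> or by its inverse changes word lengths by a bounded amount, which only affects the constants.
\<close>

lemma growth_of_coset:
  assumes A: "subgroup A G" "A \<subseteq> N" and h: "h \<in> carrier G"
  defines "m \<equiv> free_rank (G\<lparr>carrier := A\<rparr>)"
  shows "\<exists>c>0. \<exists>C>0. \<forall>\<^sub>F R in at_top. c * R ^ m \<le> real (subset_growth G S (A #> h) R) \<and>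
           real (subset_growth G S (A #> h) R) \<le> C * R ^ m"
proof -
  have AG: "A \<subseteq> carrier G" using A(1) by (rule subgroup.subset)
  obtain c C where cC: "c > 0" "C > 0" and
    lower: "\<And>R. R \<ge> 1 \<Longrightarrow> c * R ^ m \<le> real (subset_growth G S A R)" and
    upper: "\<And>R. R \<ge> 1 \<Longrightarrow> real (subset_growth G S A R) \<le> C * R ^ m"
    using growth_of_subgroup[OF A] unfolding m_def by blast
  define L where "L = real (word_length G S h)"
  define L' where "L' = real (word_length G S (inv h))"
  have "c * (1 / 2) ^ m * R ^ m \<le> real (subset_growth G S (A #> h) R)
      \<and> real (subset_growth G S (A #> h) R) \<le> C * (1 + L') ^ m * R ^ m" if R: "R \<ge> 2 * L + 2" for R
  proof
    have L0: "L \<ge> 0" "L' \<ge> 0" by (auto simp: L_def L'_def)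
    have "c * (1 / 2) ^ m * R ^ m = c * (R / 2) ^ m" by (simp add: power_divide)
    also have "\<dots> \<le> c * (R - L) ^ m"
      using R L0 cC by (intro mult_left_mono power_mono) auto
    also have "\<dots> \<le> real (subset_growth G S A (R - L))" using R L0 by (intro lower) auto
    also have "\<dots> \<le> real (subset_growth G S (A #> h) R)"
      using subset_growth_translate[OF AG h, of "R - L"] by (simp add: L_def)
    finally show "c * (1 / 2) ^ m * R ^ m \<le> real (subset_growth G S (A #> h) R)" .
    have "real (subset_growth G S (A #> h) R) \<le> real (subset_growth G S (A #> h #> inv h) (R + L'))"
      using subset_growth_translate[OF r_coset_subset_G[OF AG h], of "inv h" R] h by (simp add: L'_def)
    also have "A #> h #> inv h = A"
      using AG h by (simp add: coset_mult_assoc coset_mult_one)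
    also have "real (subset_growth G S A (R + L')) \<le> C * (R + L') ^ m"
      using R L0 by (intro upper) auto
    also have "\<dots> \<le> C * ((1 + L') * R) ^ m"
    proof (intro mult_left_mono power_mono)
      have "L' * 1 \<le> L' * R" using R L0 by (intro mult_left_mono) auto
      then show "R + L' \<le> (1 + L') * R" by (simp add: algebra_simps)
    qed (use cC R L0 in auto)
    finally show "real (subset_growth G S (A #> h) R) \<le> C * (1 + L') ^ m * R ^ m"
      by (simp add: power_mult_distrib mult_ac)
  qed
  then have "\<forall>\<^sub>F R in at_top. c * (1 / 2) ^ m * R ^ m \<le> real (subset_growth G S (A #> h) R)
      \<and> real (subset_growth G S (A #> h) R) \<le> C * (1 + L') ^ m * R ^ m"
    by (rule eventually_at_top_linorderI)
  moreover have "c * (1 / 2) ^ m > 0" "C * (1 + L') ^ m > 0"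
    using cC by (auto simp: L'_def add_pos_nonneg)
  ultimately show ?thesis by blast
qed

end

section \<open>Twisted conjugacy classes as finite unions of cosets\<close>

lemma (in group) twisted_conj_class_eq:
  assumes \<phi>: "\<phi> \<in> hom G G" and g0: "g0 \<in> carrier G"
  shows "twisted_conj_class G \<phi> g0 = (\<lambda>z. z \<otimes> g0 \<otimes> inv (\<phi> z)) ` carrier G"
proof -
  interpret \<phi>: group_hom G G \<phi>
    by unfold_locales (rule \<phi>)
  have swap: "b = inv z \<otimes> a \<otimes> inv (\<phi> (inv z))"
    if "a = z \<otimes> b \<otimes> inv (\<phi> z)" "b \<in> carrier G" "z \<in> carrier G" for a b z
  proof -
    have "inv z \<otimes> a \<otimes> inv (\<phi> (inv z)) = inv z \<otimes> (z \<otimes> b \<otimes> inv (\<phi> z)) \<otimes> \<phi> z"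
      using that by simp
    also have "\<dots> = (inv z \<otimes> z) \<otimes> b \<otimes> (inv (\<phi> z) \<otimes> \<phi> z)"
      using that by (simp only: m_assoc m_closed inv_closed \<phi>.hom_closed)
    also have "\<dots> = b" using that by simp
    finally show ?thesis by simp
  qed
  show ?thesis
  proof (intro equalityI subsetI)
    fix h assume "h \<in> twisted_conj_class G \<phi> g0"
    then obtain z where z: "h \<in> carrier G" "z \<in> carrier G" "g0 = z \<otimes> h \<otimes> inv (\<phi> z)"
      by (auto simp: twisted_conj_class_def)
    show "h \<in> (\<lambda>z. z \<otimes> g0 \<otimes> inv (\<phi> z)) ` carrier G"
      using swap[OF z(3,1,2)] inv_closed[OF z(2)] by (intro image_eqI[where x = "inv z"])
  next
    fix h assume "h \<in> (\<lambda>z. z \<otimes> g0 \<otimes> inv (\<phi> z)) ` carrier G"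
    then obtain z where z: "z \<in> carrier G" "h = z \<otimes> g0 \<otimes> inv (\<phi> z)" by blast
    then have "h \<in> carrier G" using g0 by simp
    with swap[OF z(2) g0 z(1)] inv_closed[OF z(1)] show "h \<in> twisted_conj_class G \<phi> g0"
      unfolding twisted_conj_class_def by blast
  qed
qed

context virtually_abelian_pair
begin

context
  fixes \<phi>
  assumes \<phi>: "\<phi> \<in> hom G G" and \<phi>_N: "\<phi> ` N \<subseteq> N"
begin

interpretation \<phi>: group_hom G G \<phi>
  by unfold_locales (rule \<phi>)

abbreviation D where "D \<equiv> id_minus_twist G \<phi>"

lemma N_commute: "x \<in> N \<Longrightarrow> y \<in> N \<Longrightarrow> x \<otimes> y = y \<otimes> x"
  using comm_groupE(4)[OF comm_N, of x y] by simp

lemma twist_mem_N: "g \<in> carrier G \<Longrightarrow> x \<in> N \<Longrightarrow> inner_aut G g (\<phi> x) \<in> N"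
  using inv_op_closed2[of g "\<phi> x"] \<phi>_N by (auto simp: inner_aut_def)

lemma twist_mult:
  assumes "g \<in> carrier G" "x \<in> carrier G" "y \<in> carrier G"
  shows "inner_aut G g (\<phi> (x \<otimes> y)) = inner_aut G g (\<phi> x) \<otimes> inner_aut G g (\<phi> y)"
proof -
  have "inv g \<otimes> (g \<otimes> u) = u" if "u \<in> carrier G" for u
    using assms that by (simp add: m_assoc[symmetric])
  then show ?thesis using assms by (simp add: inner_aut_def m_assoc)
qed

lemma id_minus_twist_image:
  assumes g: "g \<in> carrier G"
  shows "subgroup (D g ` N) G" "D g ` N \<subseteq> N"
proof -
  interpret NG: comm_group NG by (rule comm_N)
  have mem: "D g x \<in> N" if "x \<in> N" for x
    using that twist_mem_N[OF g that] by (simp add: id_minus_twist_def)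
  then show "D g ` N \<subseteq> N" by auto
  have "D g \<in> hom NG NG"
  proof (rule homI)
    fix x y assume "x \<in> carrier NG" "y \<in> carrier NG"
    then have xy: "x \<in> N" "y \<in> N" by auto
    let ?a = "inner_aut G g (\<phi> x)" and ?b = "inner_aut G g (\<phi> y)"
    have ab: "?a \<in> N" "?b \<in> N" using twist_mem_N g xy by auto
    have "D g (x \<otimes> y) = x \<otimes> y \<otimes> inv (?a \<otimes> ?b)"
      using twist_mult[OF g] xy by (simp add: id_minus_twist_def)
    also have "inv (?a \<otimes> ?b) = inv ?a \<otimes> inv ?b"
      using ab N_commute[OF ab] by (simp add: inv_mult_group[symmetric])
    also have "x \<otimes> y \<otimes> (inv ?a \<otimes> inv ?b) = x \<otimes> (y \<otimes> inv ?a) \<otimes> inv ?b"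
      using xy ab by (simp add: m_assoc)
    also have "y \<otimes> inv ?a = inv ?a \<otimes> y" using xy ab by (intro N_commute) auto
    also have "x \<otimes> (inv ?a \<otimes> y) \<otimes> inv ?b = D g x \<otimes> D g y"
      using xy ab by (simp add: id_minus_twist_def m_assoc)
    finally show "D g (x \<otimes>\<^bsub>NG\<^esub> y) = D g x \<otimes>\<^bsub>NG\<^esub> D g y" by simp
  qed (use mem in auto)
  then interpret Dg: group_hom NG NG "D g" by unfold_locales
  have "subgroup (D g ` N) NG" using Dg.img_is_subgroup by simp
  then show "subgroup (D g ` N) G" by (rule incl_subgroup[OF N_subgroup])
qed

text \<open>
  Replacing \<open>g\<close> by \<open>n g\<close> conjugates the value of \<open>\<tau>\<^sub>g \<circ> \<phi>\<close> by \<open>n\<close>, which is harmless because \<open>N\<close> is abelian.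
\<close>

lemma id_minus_twist_coset:
  assumes "g \<in> carrier G" "h \<in> carrier G" "N #> h = N #> g" "x \<in> N"
  shows "D h x = D g x"
proof -
  obtain n where n: "n \<in> N" "h = n \<otimes> g"
    using assms rcos_self[OF assms(2) N_subgroup] by (auto simp: r_coset_def)
  let ?a = "inner_aut G g (\<phi> x)"
  have a: "?a \<in> N" using twist_mem_N assms by auto
  have "inner_aut G h (\<phi> x) = n \<otimes> ?a \<otimes> inv n"
    using assms n by (simp add: inner_aut_def inv_mult_group m_assoc)
  also have "n \<otimes> ?a = ?a \<otimes> n" using n a by (intro N_commute)
  also have "?a \<otimes> n \<otimes> inv n = ?a" using n a by (simp add: m_assoc)
  finally show ?thesis by (simp add: id_minus_twist_def)
qed

lemma endo_rank_coset:
  assumes "g \<in> carrier G" "h \<in> carrier G" "N #> h = N #> g"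
  shows "endo_rank G N (D h) = endo_rank G N (D g)"
  using id_minus_twist_coset[OF assms] by (simp add: endo_rank_def cong: image_cong)

text \<open>
  The computation behind the whole result: with \<open>h = t g\<^sub>0 \<phi>(t)\<inverse>\<close>,
  \<open>n h \<phi>(n)\<inverse> = (n (h \<phi>(n) h\<inverse>)\<inverse>) h\<close>, and the factor in front of \<open>h\<close> is the image of \<open>n\<close> under
  \<open>Id - \<tau>\<^sub>h \<circ> \<phi>\<close>.
\<close>

lemma twisted_translate:
  assumes "t \<in> carrier G" "g0 \<in> carrier G" "n \<in> N"
  defines "h \<equiv> t \<otimes> g0 \<otimes> inv (\<phi> t)"
  shows "(n \<otimes> t) \<otimes> g0 \<otimes> inv (\<phi> (n \<otimes> t)) = D h n \<otimes> h"
proof -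
  have n: "n \<in> carrier G" and h: "h \<in> carrier G" using assms by auto
  have "(n \<otimes> t) \<otimes> g0 \<otimes> inv (\<phi> (n \<otimes> t)) = n \<otimes> h \<otimes> inv (\<phi> n)"
    using assms n by (simp add: h_def inv_mult_group m_assoc)
  also have "\<dots> = n \<otimes> (h \<otimes> inv (\<phi> n) \<otimes> inv h) \<otimes> h"
    using n h by (simp add: m_assoc)
  also have "h \<otimes> inv (\<phi> n) \<otimes> inv h = inv (inner_aut G h (\<phi> n))"
    using n h by (simp add: inner_aut_def inv_mult_group m_assoc)
  finally show ?thesis by (simp add: id_minus_twist_def)
qed

text \<open>
  As \<open>z = n t\<close> runs through \<open>G\<close>, the representative \<open>t\<close> takes finitely many values, and for fixed \<open>t\<close> the
  element \<open>z g\<^sub>0 \<phi>(z)\<inverse>\<close> runs through one coset of the image of \<open>Id - \<tau>\<^sub>h \<circ> \<phi>\<close>.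
\<close>

lemma twisted_conj_class_decomposition:
  assumes g0: "g0 \<in> carrier G"
  obtains H where "finite H" "H \<subseteq> twisted_conj_class G \<phi> g0"
    "twisted_conj_class G \<phi> g0 = (\<Union>h\<in>H. D h ` N #> h)"
proof -
  define \<tau> where "\<tau> z = z \<otimes> g0 \<otimes> inv (\<phi> z)" for z
  note cls = twisted_conj_class_eq[OF \<phi> g0]
  have coset: "D (\<tau> t) ` N #> \<tau> t = (\<lambda>n. \<tau> (n \<otimes> t)) ` N" if "t \<in> carrier G" for t
    using twisted_translate[OF that g0] by (auto simp: \<tau>_def r_coset_def)
  define T where "T = (\<lambda>C. SOME t. t \<in> C) ` (rcosets N)"
  have T_mem: "(SOME t. t \<in> N #> z) \<in> N #> z" if "z \<in> carrier G" for z
    using rcos_self[OF that N_subgroup] by (rule someI)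
  then have T: "T \<subseteq> carrier G"
    using elemrcos_carrier[OF is_group] by (auto simp: T_def RCOSETS_def)
  have cover: "\<exists>t\<in>T. \<exists>n\<in>N. z = n \<otimes> t" if z: "z \<in> carrier G" for z
  proof -
    define t where "t = (SOME t. t \<in> N #> z)"
    have "z \<in> N #> t"
      using repr_independence[OF T_mem[OF z] z N_subgroup] rcos_self[OF z N_subgroup]
      unfolding t_def by simp
    moreover have "t \<in> T" using z by (auto simp: t_def T_def RCOSETS_def)
    ultimately show ?thesis by (auto simp: r_coset_def)
  qed
  have "twisted_conj_class G \<phi> g0 = (\<Union>h\<in>\<tau> ` T. D h ` N #> h)"
  proof -
    have "(\<Union>h\<in>\<tau> ` T. D h ` N #> h) = (\<Union>t\<in>T. (\<lambda>n. \<tau> (n \<otimes> t)) ` N)"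
      using coset T by (simp add: subset_iff cong: SUP_cong)
    also have "\<dots> = \<tau> ` carrier G"
    proof
      show "(\<Union>t\<in>T. (\<lambda>n. \<tau> (n \<otimes> t)) ` N) \<subseteq> \<tau> ` carrier G"
        using T by auto
      show "\<tau> ` carrier G \<subseteq> (\<Union>t\<in>T. (\<lambda>n. \<tau> (n \<otimes> t)) ` N)"
        using cover by fast
    qed
    finally show ?thesis by (simp add: cls \<tau>_def)
  qed
  moreover have "finite (\<tau> ` T)" using finite_index by (simp add: T_def)
  moreover have "\<tau> ` T \<subseteq> twisted_conj_class G \<phi> g0" using T by (auto simp: cls \<tau>_def)
  ultimately show ?thesis using that by blast
qed

lemma twisted_coset_subset_class:
  assumes g0: "g0 \<in> carrier G" and h: "h \<in> twisted_conj_class G \<phi> g0"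
  shows "D h ` N #> h \<subseteq> twisted_conj_class G \<phi> g0"
proof -
  note cls = twisted_conj_class_eq[OF \<phi> g0]
  obtain t where t: "t \<in> carrier G" "h = t \<otimes> g0 \<otimes> inv (\<phi> t)" using h by (auto simp: cls)
  show ?thesis
  proof
    fix u assume "u \<in> D h ` N #> h"
    then obtain n where n: "n \<in> N" "u = D h n \<otimes> h" by (auto simp: r_coset_def)
    then have "u = (n \<otimes> t) \<otimes> g0 \<otimes> inv (\<phi> (n \<otimes> t))"
      using twisted_translate[OF t(1) g0 n(1)] t(2) by simp
    then show "u \<in> twisted_conj_class G \<phi> g0"
      using t n unfolding cls by (intro rev_image_eqI[of "n \<otimes> t"]) auto
  qed
qed

text \<open>
  A finite union of cosets grows like its fastest growing member. The ranks that occur for the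
  cosets \<open>gN\<close> meeting the class are exactly those of its elements, and those of the
  finite set \<open>H\<close> of translates suffice; hence the maximum is over a finite nonempty set and is attained.
\<close>

lemma twisted_conj_class_growth:
  assumes g0: "g0 \<in> carrier G"
    and k: "k = Max {endo_rank G N (D g) | g. g \<in> carrier G \<and>
           twisted_conj_class G \<phi> g0 \<inter> {h \<in> carrier G. quot_proj G N h = quot_proj G N g} \<noteq> {}}"
  shows "(\<lambda>r::real. real (subset_growth G S (twisted_conj_class G \<phi> g0) r)) \<in> \<Theta>(\<lambda>r. r ^ k)"
proof -
  define C where "C = twisted_conj_class G \<phi> g0"
  have CG: "C \<subseteq> carrier G" by (auto simp: C_def twisted_conj_class_def)
  obtain H where H: "finite H" "H \<subseteq> C" and C_eq: "C = (\<Union>h\<in>H. D h ` N #> h)"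
    using twisted_conj_class_decomposition[OF g0] unfolding C_def by metis
  have g0C: "g0 \<in> C"
    using g0 \<phi>.hom_one by (auto simp: C_def twisted_conj_class_def intro!: bexI[of _ \<one>])
  let ?rk = "\<lambda>g. endo_rank G N (D g)"
  have growth: "\<exists>c>0. \<exists>c'>0. \<forall>\<^sub>F R in at_top.
       c * R ^ ?rk h \<le> real (subset_growth G S (D h ` N #> h) R) \<and>
       real (subset_growth G S (D h ` N #> h) R) \<le> c' * R ^ ?rk h" if "h \<in> C" for h
    using growth_of_coset[of "D h ` N" h] id_minus_twist_image[of h] that CG
    unfolding endo_rank_def by blast
  have ranks: "{?rk g | g. g \<in> carrier G \<and> C \<inter> {h \<in> carrier G. quot_proj G N h = quot_proj G N g} \<noteq> {}}
       = ?rk ` C" (is "?E = _")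
  proof (intro equalityI subsetI)
    fix q assume "q \<in> ?E"
    then obtain g h where "q = ?rk g" "g \<in> carrier G" "h \<in> C" "h \<in> carrier G" "N #> h = N #> g"
      by (auto simp: quot_proj_def)
    then have "q = ?rk h" using endo_rank_coset[of g h] by simp
    then show "q \<in> ?rk ` C" using \<open>h \<in> C\<close> by (rule image_eqI)
  next
    fix q assume "q \<in> ?rk ` C"
    then show "q \<in> ?E" using CG by blast
  qed
  have "?rk ` C \<subseteq> ?rk ` H"
  proof
    fix q assume "q \<in> ?rk ` C"
    then obtain u where u: "u \<in> C" "q = ?rk u" by blast
    then obtain h n where h: "h \<in> H" "n \<in> N" "u = D h n \<otimes> h"
      unfolding C_eq by (auto simp: r_coset_def)
    have hG: "h \<in> carrier G" using h H CG by auto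
    then have "u \<in> N #> h" using h id_minus_twist_image(2)[OF hG] by (auto simp: r_coset_def)
    then have "N #> u = N #> h" using repr_independence[OF _ hG N_subgroup] by simp
    then have "?rk u = ?rk h" using u CG hG by (intro endo_rank_coset) auto
    with u h show "q \<in> ?rk ` H" by auto
  qed
  then have fin: "finite (?rk ` C)" using H finite_subset by blast
  have k': "k = Max (?rk ` C)" using k ranks unfolding C_def by simp
  then have k_ge: "?rk h \<le> k" if "h \<in> C" for h using fin that by simp
  have "k \<in> ?rk ` C" unfolding k' using fin g0C by (intro Max_in) auto
  then obtain h0 where h0: "h0 \<in> C" "?rk h0 = k" by blast

  obtain c where c: "c > 0"
    and lower: "\<forall>\<^sub>F R in at_top. c * R ^ k \<le> real (subset_growth G S (D h0 ` N #> h0) R)"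
    using growth[OF h0(1)] h0(2) by (auto simp: eventually_conj_iff)
  have "\<exists>c'>0. \<forall>\<^sub>F R in at_top. real (subset_growth G S (D h ` N #> h) R) \<le> c' * R ^ k"
    if h: "h \<in> C" for h
  proof -
    obtain c' where c': "c' > 0"
      and upper: "\<forall>\<^sub>F R in at_top. real (subset_growth G S (D h ` N #> h) R) \<le> c' * R ^ ?rk h"
      using growth[OF h] by (auto simp: eventually_conj_iff)
    have "\<forall>\<^sub>F R in at_top. real (subset_growth G S (D h ` N #> h) R) \<le> c' * R ^ k"
      using upper eventually_ge_at_top[of 1]
    proof eventually_elim
      case (elim R)
      have "R ^ ?rk h \<le> R ^ k" using elim k_ge[OF h] by (intro power_increasing) auto
      then have "c' * R ^ ?rk h \<le> c' * R ^ k" using c' by simp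
      with elim show ?case by linarith
    qed
    with c' show ?thesis by blast
  qed
  then obtain c' where c': "\<And>h. h \<in> C \<Longrightarrow> c' h > 0"
    and upper: "\<And>h. h \<in> C \<Longrightarrow>
      \<forall>\<^sub>F R in at_top. real (subset_growth G S (D h ` N #> h) R) \<le> c' h * R ^ k"
    by metis
  have "H \<noteq> {}" using g0C C_eq by auto
  then have pos: "(\<Sum>h\<in>H. c' h) > 0" using H c' by (intro sum_pos) auto
  have "\<forall>\<^sub>F R in at_top. \<forall>h\<in>H. real (subset_growth G S (D h ` N #> h) R) \<le> c' h * R ^ k"
    using H upper by (intro eventually_ball_finite) auto
  then have "\<forall>\<^sub>F R::real in at_top. c * norm (R ^ k) \<le> norm (real (subset_growth G S C R)) \<and>
        norm (real (subset_growth G S C R)) \<le> (\<Sum>h\<in>H. c' h) * norm (R ^ k)"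
    using lower eventually_ge_at_top[of 0]
  proof eventually_elim
    case (elim R)
    have "real (subset_growth G S (D h0 ` N #> h0) R) \<le> real (subset_growth G S C R)"
      using twisted_coset_subset_class[OF g0] h0(1) CG unfolding C_def
      by (intro of_nat_mono subset_growth_mono) auto
    moreover have "real (subset_growth G S C R) \<le> (\<Sum>h\<in>H. c' h) * R ^ k"
    proof -
      have "subset_growth G S C R \<le> (\<Sum>h\<in>H. subset_growth G S (D h ` N #> h) R)"
        unfolding C_eq by (rule subset_growth_UN_le[OF H(1)])
      then have "real (subset_growth G S C R) \<le> (\<Sum>h\<in>H. real (subset_growth G S (D h ` N #> h) R))"
        by (metis of_nat_le_iff of_nat_sum)
      also have "\<dots> \<le> (\<Sum>h\<in>H. c' h * R ^ k)" using elim by (intro sum_mono) auto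
      finally show ?thesis by (simp add: sum_distrib_right)
    qed
    ultimately show ?case using elim by simp
  qed
  with c pos show ?thesis unfolding C_def by (rule bigthetaI')
qed

end

end

theorem theorem3:
  fixes G :: "('a, 'b) monoid_scheme" (structure)
    and S N :: "'a set" and \<phi> :: "'a \<Rightarrow> 'a" and g0 :: 'a and k :: nat
  assumes "group G"
    and "virtually_abelian G"
    and "finite S" and "S \<subseteq> carrier G" and "generate G S = carrier G"
    and "N \<lhd> G" and "comm_group (G\<lparr>carrier := N\<rparr>)" and "torsion_free (G\<lparr>carrier := N\<rparr>)"
    and "finite (carrier (G Mod N))"
    and "\<phi> \<in> hom G G" and "\<phi> ` N \<subseteq> N"
    and "g0 \<in> carrier G"
    and k_def: "k = Max {endo_rank G N (id_minus_twist G \<phi> g) | g.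
           g \<in> carrier G \<and>
           twisted_conj_class G \<phi> g0 \<inter> {h \<in> carrier G. quot_proj G N h = quot_proj G N g} \<noteq> {}}"
  shows "(\<lambda>r::real. real (subset_growth G S (twisted_conj_class G \<phi> g0) r)) \<in> \<Theta>(\<lambda>r. r ^ k)"
proof -
  interpret group G by fact
  interpret finitely_generated_group G S
    using assms by unfold_locales
  interpret normal N G by fact
  interpret virtually_abelian_pair G S N
    by (rule virtually_abelian_pair.intro[OF finitely_generated_group_axioms normal_axioms
          virtually_abelian_pair_axioms.intro]) (use assms in \<open>simp_all add: FactGroup_def\<close>)
  show ?thesis
    using twisted_conj_class_growth assms(10-12) k_def by blast
qed

end
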